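(* Let $\mathcal{A}$ be a unital $C^*$-algebra, let $\phi:\mathcal{A}\to\mathbb{C}$ be a state, and let $x_1,\dots,x_n$ be self-adjoint elements of $\mathcal{A}$ with $\phi(x_j)=0$ for all $1\le j\le n$. Let $\mathrm{Cov}_\phi(\tilde{x})$ be the $n\times n$ matrix with $(i,j)$ entry $\mathrm{Re}\,\phi(x_ix_j)$, and let $\left(\tfrac12\phi([x_i,x_j])\right)$ be the $n\times n$ matrix with $(i,j)$ entry $\tfrac12\phi([x_i,x_j])$. Then $$\det\left(\tfrac12\phi([x_i,x_j])\right)^2\le \det\left(\mathrm{Cov}_\phi(\tilde{x})\right)^2.$$
   Context: A state is a positive linear functional $\phi$ with $\phi(1)=1$. The commutator is $[x,y]=xy-yx$. The matrix $\mathrm{Cov}_\phi(\tilde x)=\left(\mathrm{Re}\,\phi(x_ix_j)\right)_{i,j=1}^n$ is the covariance matrix of the $n$-tuple $\tilde{x}=(x_j)_{j=1}^n$; it is a positive semidefinite matrix. *)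

theory Defs
  imports "HOL-Analysis.Analysis" "HOL-Library.Complex_Order"
begin

class star =
  fixes star :: "'a \<Rightarrow> 'a"

class scaleC =
  fixes scaleC :: "complex \<Rightarrow> 'a \<Rightarrow> 'a" (infixr \<open>*\<^sub>C\<close> 75)

text \<open>
  Unital \<open>C\<^sup>*\<close>-algebras: complex unital Banach algebras with an involution satisfying the \<open>C\<^sup>*\<close>-identity.
  The underlying real Banach algebra structure is the one of \<^class>\<open>real_normed_algebra_1\<close> and
  \<^class>\<open>banach\<close>, and \<open>scaleR_scaleC\<close> says that real scaling is the restriction of complex
  scaling. The superclass contains \<^prop>\<open>0 \<noteq> 1\<close>, which any algebra carrying a state satisfies,
  and \<^prop>\<open>norm 1 = 1\<close>, which holds in every nonzero unital \<open>C\<^sup>*\<close>-algebra.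
\<close>

class unital_cstar_algebra = real_normed_algebra_1 + banach + scaleC + star +
  assumes scaleC_add_right: "c *\<^sub>C (x + y) = c *\<^sub>C x + c *\<^sub>C y"
    and scaleC_add_left: "(c + d) *\<^sub>C x = c *\<^sub>C x + d *\<^sub>C x"
    and scaleC_scaleC: "c *\<^sub>C (d *\<^sub>C x) = (c * d) *\<^sub>C x"
    and scaleC_one: "1 *\<^sub>C x = x"
    and scaleR_scaleC: "r *\<^sub>R x = complex_of_real r *\<^sub>C x"
    and mult_scaleC_left: "(c *\<^sub>C x) * y = c *\<^sub>C (x * y)"
    and mult_scaleC_right: "x * (c *\<^sub>C y) = c *\<^sub>C (x * y)"
    and norm_scaleC: "norm (c *\<^sub>C x) = cmod c * norm x"
    and star_add: "star (x + y) = star x + star y"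
    and star_scaleC: "star (c *\<^sub>C x) = cnj c *\<^sub>C star x"
    and star_mult: "star (x * y) = star y * star x"
    and star_star: "star (star x) = x"
    and cstar_identity: "norm (star x * x) = (norm x)\<^sup>2"

definition selfadjoint :: "'a::unital_cstar_algebra \<Rightarrow> bool"
  where "selfadjoint x \<longleftrightarrow> star x = x"

text \<open>
  The order on \<^typ>\<open>complex\<close> is that of \<^theory>\<open>HOL-Library.Complex_Order\<close>:
  \<open>z \<le> w\<close> means \<^prop>\<open>Re z \<le> Re w \<and> Im z = Im w\<close>. So \<open>0 \<le> z\<close> says that \<open>z\<close> is real and nonnegative.
\<close>

definition positive_linear_functional :: "('a::unital_cstar_algebra \<Rightarrow> complex) \<Rightarrow> bool"
  where "positive_linear_functional \<phi> \<longleftrightarrow>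
    Vector_Spaces.linear (*\<^sub>C) (*) \<phi> \<and> (\<forall>a. 0 \<le> \<phi> (star a * a))"

definition state :: "('a::unital_cstar_algebra \<Rightarrow> complex) \<Rightarrow> bool"
  where "state \<phi> \<longleftrightarrow> positive_linear_functional \<phi> \<and> \<phi> 1 = 1"

definition commutator :: "'a::ring \<Rightarrow> 'a \<Rightarrow> 'a"
  where "commutator x y = x * y - y * x"

definition Cov :: "('a::unital_cstar_algebra \<Rightarrow> complex) \<Rightarrow> 'a ^ 'n \<Rightarrow> real ^ 'n ^ 'n"
  where "Cov \<phi> x = (\<chi> i j. Re (\<phi> (x $ i * x $ j)))"

end

theory Submission
  imports Defs
begin

text \<open>
  Write \<open>\<phi>(x\<^sub>i x\<^sub>j) = C\<^sub>i\<^sub>j + \<i> S\<^sub>i\<^sub>j\<close> with real matrices \<open>C\<close> and \<open>S\<close>. Since \<open>\<phi>\<close> is positive, it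
  is hermitian on products of self-adjoint elements, so \<open>C\<close> is the (symmetric) covariance matrix and
  the commutator matrix is \<open>\<i> S\<close>; its squared determinant is \<open>(-1)\<^sup>n (det S)\<^sup>2\<close>. It remains to see that
  \<open>\<bar>det S\<bar> \<le> \<bar>det C\<bar>\<close>.

  Positivity of \<open>\<phi>\<close> on \<open>(a + \<i> b)\<^sup>* (a + \<i> b)\<close>, for real combinations \<open>a\<close>, \<open>b\<close> of the \<open>x\<^sub>j\<close>, is the
  uncertainty relation \<open>2 \<langle>u, S v\<rangle> \<le> \<langle>u, C u\<rangle> + \<langle>v, C v\<rangle>\<close> for real vectors \<open>u\<close>, \<open>v\<close>
  (\<open>positive_linear_functional_uncertainty\<close>). The rest is real linear algebra
  (\<open>abs_det_le_of_dominated_form\<close>). If \<open>C u = 0\<close>, scaling \<open>u\<close> in this relation forces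
  \<open>\<langle>u, S v\<rangle> = 0\<close> for all \<open>v\<close>; so if \<open>C\<close> is singular, \<open>S\<close> is too. Otherwise put
  \<open>T = C\<^sup>-\<^sup>1 S\<close>. The relation at \<open>u = T v\<close> says that \<open>T\<close> is a contraction for the norm given by
  \<open>C\<close>, and a contraction has \<open>\<bar>det T\<bar> \<le> 1\<close>: its powers are contractions too, so the entries of
  \<open>C T\<^sup>k\<close>, and with them \<open>\<bar>det C\<bar> \<bar>det T\<bar>\<^sup>k\<close>, stay bounded as \<open>k\<close> grows
  (\<open>abs_det_contraction_le_1\<close>).
\<close>

section \<open>Determinants of contractions\<close>

lemma abs_det_le_entry_bound:
  fixes A :: "real ^ 'n ^ 'n"
  assumes "\<And>i j. \<bar>A $ i $ j\<bar> \<le> B"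
  shows "\<bar>det A\<bar> \<le> fact CARD('n) * B ^ CARD('n)"
proof -
  let ?P = "{p. p permutes (UNIV :: 'n set)}"
  have "\<bar>det A\<bar> \<le> (\<Sum>p\<in>?P. \<bar>of_int (sign p) * (\<Prod>i\<in>UNIV. A $ i $ p i)\<bar>)"
    unfolding det_def by (rule sum_abs)
  also have "\<dots> \<le> (\<Sum>p\<in>?P. B ^ CARD('n))"
  proof (rule sum_mono)
    fix p
    have "\<bar>\<Prod>i\<in>UNIV. A $ i $ p i\<bar> = (\<Prod>i\<in>UNIV. \<bar>A $ i $ p i\<bar>)"
      by (rule abs_prod)
    also have "\<dots> \<le> (\<Prod>i\<in>(UNIV :: 'n set). B)"
      by (rule prod_mono) (use assms in auto)
    finally show "\<bar>of_int (sign p) * (\<Prod>i\<in>UNIV. A $ i $ p i)\<bar> \<le> B ^ CARD('n)"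
      by (simp add: abs_mult sign_def)
  qed
  also have "\<dots> = fact CARD('n) * B ^ CARD('n)"
    by (simp add: card_permutations)
  finally show ?thesis .
qed

lemma inner_matrix_sym:
  fixes C :: "real ^ 'n ^ 'n"
  assumes "transpose C = C"
  shows "u \<bullet> (C *v v) = v \<bullet> (C *v u)"
  by (metis assms dot_lmul_matrix inner_commute transpose_matrix_vector)

text \<open>Expand \<open>\<langle>u \<plusminus> v, C (u \<plusminus> v)\<rangle> \<ge> 0\<close>.\<close>

lemma psd_abs_inner_le:
  fixes C :: "real ^ 'n ^ 'n"
  assumes sym: "transpose C = C" and psd: "\<And>u. 0 \<le> u \<bullet> (C *v u)"
  shows "2 * \<bar>u \<bullet> (C *v v)\<bar> \<le> u \<bullet> (C *v u) + v \<bullet> (C *v v)"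
proof -
  have "(u + v) \<bullet> (C *v (u + v)) = u \<bullet> (C *v u) + v \<bullet> (C *v v) + 2 * (u \<bullet> (C *v v))"
    using inner_matrix_sym[OF sym, of v u]
    by (simp add: matrix_vector_right_distrib inner_add_left inner_add_right)
  moreover have "(u - v) \<bullet> (C *v (u - v)) = u \<bullet> (C *v u) + v \<bullet> (C *v v) - 2 * (u \<bullet> (C *v v))"
    using inner_matrix_sym[OF sym, of v u]
    by (simp add: matrix_vector_mult_diff_distrib inner_diff_left inner_diff_right)
  ultimately show ?thesis
    using psd[of "u + v"] psd[of "u - v"] by linarith
qed

text \<open>
  The entries of \<open>C T\<^sup>k\<close> are \<open>\<langle>e\<^sub>i, C (T\<^sup>k e\<^sub>j)\<rangle>\<close>, which \<open>psd_abs_inner_le\<close> bounds by the values of the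
  form at \<open>e\<^sub>i\<close> and \<open>T\<^sup>k e\<^sub>j\<close>; the latter is at most its value at \<open>e\<^sub>j\<close>. So \<open>\<bar>det C\<bar> \<bar>det T\<bar>\<^sup>k\<close> is
  bounded in \<open>k\<close>.
\<close>

lemma abs_det_contraction_le_1:
  fixes C T :: "real ^ 'n ^ 'n"
  assumes sym: "transpose C = C" and psd: "\<And>u. 0 \<le> u \<bullet> (C *v u)" and "det C \<noteq> 0"
    and contr: "\<And>v. (T *v v) \<bullet> (C *v (T *v v)) \<le> v \<bullet> (C *v v)"
  shows "\<bar>det T\<bar> \<le> 1"
proof (rule ccontr)
  define q where "q v = v \<bullet> (C *v v)" for v
  define B where "B = (\<Sum>i\<in>UNIV. q (axis i 1))"
  \<comment> \<open>The witness is the matrix power \<open>T\<^sup>k\<close>.\<close>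
  have power: "\<exists>M. det M = det T ^ k \<and> (\<forall>v. q (M *v v) \<le> q v)" for k
  proof (induction k)
    case 0
    show ?case by (rule exI[of _ "mat 1"]) simp
  next
    case (Suc k)
    then obtain M where M: "det M = det T ^ k" "\<And>v. q (M *v v) \<le> q v" by blast
    have "q ((T ** M) *v v) \<le> q v" for v
      using contr[of "M *v v"] M(2)[of v] by (simp add: q_def matrix_vector_mul_assoc)
    then show ?case
      using M(1) by (intro exI[of _ "T ** M"]) (simp add: det_mul)
  qed
  have q_axis: "q (axis i 1) \<le> B" for i
    unfolding B_def by (rule member_le_sum) (auto simp: q_def psd)
  have bound: "\<bar>det C\<bar> * \<bar>det T\<bar> ^ k \<le> fact CARD('n) * B ^ CARD('n)" for k
  proof -
    obtain M where M: "det M = det T ^ k" "\<And>v. q (M *v v) \<le> q v"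
      using power by blast
    have "\<bar>(C ** M) $ i $ j\<bar> \<le> B" for i j
    proof -
      have "(C ** M) $ i $ j = axis i 1 \<bullet> ((C ** M) *v axis j 1)"
        by (simp only: matrix_vector_mult_basis inner_axis' column_def vec_lambda_beta mult_1 inner_real_def)
      then have "(C ** M) $ i $ j = axis i 1 \<bullet> (C *v (M *v axis j 1))"
        by (simp add: matrix_vector_mul_assoc)
      then have "2 * \<bar>(C ** M) $ i $ j\<bar> \<le> q (axis i 1) + q (M *v axis j 1)"
        using psd_abs_inner_le[OF sym psd] by (simp add: q_def)
      then show ?thesis
        using M(2)[of "axis j 1"] q_axis[of i] q_axis[of j] by linarith
    qed
    from abs_det_le_entry_bound[OF this] show ?thesis
      by (simp add: det_mul M(1) abs_mult power_abs)
  qed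
  assume "\<not> \<bar>det T\<bar> \<le> 1"
  then obtain k where "fact CARD('n) * B ^ CARD('n) / \<bar>det C\<bar> < \<bar>det T\<bar> ^ k"
    using real_arch_pow[of "\<bar>det T\<bar>"] by force
  with bound[of k] \<open>det C \<noteq> 0\<close> show False
    by (simp add: field_simps)
qed

text \<open>
  For invertible \<open>C\<close>, the hypothesis at \<open>u = C\<^sup>-\<^sup>1 S v\<close> has left side \<open>2 \<langle>u, C u\<rangle>\<close>, which makes
  \<open>C\<^sup>-\<^sup>1 S\<close> a contraction for the form of \<open>C\<close>.
\<close>

lemma abs_det_le_of_dominated_form:
  fixes C S :: "real ^ 'n ^ 'n"
  assumes sym: "transpose C = C"
    and dom: "\<And>u v. 2 * (u \<bullet> (S *v v)) \<le> u \<bullet> (C *v u) + v \<bullet> (C *v v)"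
  shows "\<bar>det S\<bar> \<le> \<bar>det C\<bar>"
proof (cases "det C = 0")
  case True
  then obtain u where u: "u \<noteq> 0" "C *v u = 0"
    by (metis invertible_det_nz invertible_left_inverse matrix_left_invertible_ker)
  have "u \<bullet> (S *v v) = 0" for v
  proof (rule ccontr)
    assume ne: "u \<bullet> (S *v v) \<noteq> 0"
    \<comment> \<open>The multiple of \<open>u\<close> for which the left side of \<open>dom\<close> exceeds \<open>\<langle>v, C v\<rangle>\<close> by 1.\<close>
    define t where "t = (v \<bullet> (C *v v) + 1) / (2 * (u \<bullet> (S *v v)))"
    have "2 * (t * (u \<bullet> (S *v v))) \<le> v \<bullet> (C *v v)"
      using dom[of "t *\<^sub>R u" v] u(2) by (simp add: matrix_vector_mult_scaleR)
    moreover have "2 * (t * (u \<bullet> (S *v v))) = v \<bullet> (C *v v) + 1"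
      using ne by (simp add: t_def)
    ultimately show False by simp
  qed
  then have "u v* S = 0"
    by (metis dot_lmul_matrix inner_eq_zero_iff)
  then have "transpose S *v u = 0"
    by simp
  then have "det (transpose S) = 0"
    using u(1) by (metis invertible_det_nz invertible_left_inverse matrix_left_invertible_ker)
  then show ?thesis by simp
next
  case False
  then obtain D where D: "C ** D = mat 1"
    by (metis invertible_det_nz invertible_right_inverse)
  define T where "T = D ** S"
  have CT: "C ** T = S"
    by (simp add: T_def matrix_mul_assoc D)
  have "(T *v v) \<bullet> (C *v (T *v v)) \<le> v \<bullet> (C *v v)" for v
    using dom[of "T *v v" v] by (simp add: matrix_vector_mul_assoc CT)
  moreover have "0 \<le> u \<bullet> (C *v u)" for u
    using dom[of u 0] by simp
  ultimately have "\<bar>det T\<bar> \<le> 1"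
    using sym False by (intro abs_det_contraction_le_1[of C T])
  moreover have "det S = det C * det T"
    by (simp flip: CT add: det_mul)
  ultimately show ?thesis
    by (simp add: abs_mult mult_left_le)
qed

section \<open>Positive functionals on self-adjoint elements\<close>

lemma positive_linear_functional_add:
  "positive_linear_functional \<phi> \<Longrightarrow> \<phi> (a + b) = \<phi> a + \<phi> b"
  unfolding positive_linear_functional_def Vector_Spaces.linear_def
    module_hom_def module_hom_axioms_def by blast

lemma positive_linear_functional_scaleC:
  "positive_linear_functional \<phi> \<Longrightarrow> \<phi> (c *\<^sub>C a) = c * \<phi> a"
  unfolding positive_linear_functional_def Vector_Spaces.linear_def
    module_hom_def module_hom_axioms_def by blast

lemma positive_linear_functional_scaleR:
  "positive_linear_functional \<phi> \<Longrightarrow> \<phi> (r *\<^sub>R a) = of_real r * \<phi> a"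
  by (simp add: scaleR_scaleC positive_linear_functional_scaleC)

lemma positive_linear_functional_zero:
  "positive_linear_functional \<phi> \<Longrightarrow> \<phi> 0 = 0"
  using positive_linear_functional_add[of \<phi> 0 0] by simp

lemma positive_linear_functional_diff:
  "positive_linear_functional \<phi> \<Longrightarrow> \<phi> (a - b) = \<phi> a - \<phi> b"
  using positive_linear_functional_add[of \<phi> "a - b" b] by simp

lemma positive_linear_functional_sum:
  "positive_linear_functional \<phi> \<Longrightarrow> \<phi> (\<Sum>i\<in>I. f i) = (\<Sum>i\<in>I. \<phi> (f i))"
  by (induction I rule: infinite_finite_induct)
    (simp_all add: positive_linear_functional_zero positive_linear_functional_add)

lemma selfadjoint_zero: "selfadjoint 0"
  using star_add[of 0 0] by (simp add: selfadjoint_def)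

lemma selfadjoint_add: "selfadjoint a \<Longrightarrow> selfadjoint b \<Longrightarrow> selfadjoint (a + b)"
  by (simp add: selfadjoint_def star_add)

lemma selfadjoint_scaleR: "selfadjoint a \<Longrightarrow> selfadjoint (r *\<^sub>R a)"
  by (simp add: selfadjoint_def scaleR_scaleC star_scaleC)

lemma selfadjoint_sum: "(\<And>i. i \<in> I \<Longrightarrow> selfadjoint (f i)) \<Longrightarrow> selfadjoint (\<Sum>i\<in>I. f i)"
  by (induction I rule: infinite_finite_induct) (simp_all add: selfadjoint_zero selfadjoint_add)

lemma positive_linear_functional_square:
  "positive_linear_functional \<phi> \<Longrightarrow> selfadjoint a \<Longrightarrow> 0 \<le> \<phi> (a * a)"
  unfolding positive_linear_functional_def selfadjoint_def by metis

text \<open>The right side is \<open>\<phi>\<close> at \<open>(a + \<i> b)\<^sup>* (a + \<i> b)\<close>, expanded.\<close>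

lemma positive_linear_functional_complex_square:
  assumes \<phi>: "positive_linear_functional \<phi>" and a: "selfadjoint a" and b: "selfadjoint b"
  shows "0 \<le> \<phi> (a * a) + \<phi> (b * b) + \<i> * (\<phi> (a * b) - \<phi> (b * a))"
proof -
  have "star (a + \<i> *\<^sub>C b) * (a + \<i> *\<^sub>C b)
      = a * a + (\<i> *\<^sub>C (a * b) + ((- \<i>) *\<^sub>C (b * a) + ((- \<i>) * \<i>) *\<^sub>C (b * b)))"
    using a b unfolding selfadjoint_def
    by (simp only: star_add star_scaleC distrib_left distrib_right mult_scaleC_left
        mult_scaleC_right scaleC_add_right scaleC_scaleC complex_cnj_i)
      (simp add: algebra_simps scaleC_one)
  moreover have "0 \<le> \<phi> (star (a + \<i> *\<^sub>C b) * (a + \<i> *\<^sub>C b))"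
    using \<phi> unfolding positive_linear_functional_def by blast
  ultimately show ?thesis
    by (simp add: positive_linear_functional_add[OF \<phi>] positive_linear_functional_scaleC[OF \<phi>]
        algebra_simps)
qed

text \<open>
  Values at squares of self-adjoint elements are real. The square of \<open>a + b\<close> then shows that the
  imaginary parts are opposite, and \<open>(a + \<i> b)\<^sup>* (a + \<i> b)\<close> that the real parts agree.
\<close>

lemma positive_linear_functional_cnj:
  assumes \<phi>: "positive_linear_functional \<phi>" and a: "selfadjoint a" and b: "selfadjoint b"
  shows "\<phi> (b * a) = cnj (\<phi> (a * b))"
proof -
  note sq = positive_linear_functional_square[OF \<phi>]
  have im: "Im (\<phi> (a * a)) = 0" "Im (\<phi> (b * b)) = 0" "Im (\<phi> ((a + b) * (a + b))) = 0"
    using sq[OF a] sq[OF b] sq[OF selfadjoint_add[OF a b]] by (auto simp: less_eq_complex_def)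
  then have "Im (\<phi> (b * a)) = - Im (\<phi> (a * b))"
    by (simp add: distrib_left distrib_right positive_linear_functional_add[OF \<phi>])
  moreover have "Re (\<phi> (b * a)) = Re (\<phi> (a * b))"
    using positive_linear_functional_complex_square[OF \<phi> a b] im
    by (simp add: less_eq_complex_def)
  ultimately show ?thesis
    by (simp add: complex_eq_iff)
qed

text \<open>
  Since \<open>\<phi>(a b) - \<phi>(b a) = 2 \<i> Im \<phi>(a b)\<close>, this is positivity at \<open>(a + \<i> b)\<^sup>* (a + \<i> b)\<close>. It is the
  uncertainty relation in additive form, which stays linear in \<open>\<phi>(a b)\<close>.
\<close>

lemma positive_linear_functional_uncertainty:
  assumes \<phi>: "positive_linear_functional \<phi>" and a: "selfadjoint a" and b: "selfadjoint b"
  shows "2 * Im (\<phi> (a * b)) \<le> Re (\<phi> (a * a)) + Re (\<phi> (b * b))"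
  using positive_linear_functional_complex_square[OF \<phi> a b]
    positive_linear_functional_cnj[OF \<phi> a b]
  by (simp add: less_eq_complex_def)

section \<open>The determinant inequality\<close>

lemma det_complex_of_real:
  "det (\<chi> i j. complex_of_real (A $ i $ j)) = complex_of_real (det A)"
  by (simp add: det_def)

theorem theorem1:
  fixes \<phi> :: "'a::unital_cstar_algebra \<Rightarrow> complex"
    and x :: "'a ^ 'n"
  assumes "state \<phi>"
    and "\<forall>j. selfadjoint (x $ j)"
    and "\<forall>j. \<phi> (x $ j) = 0"
  shows "(det (\<chi> i j. 1 / 2 * \<phi> (commutator (x $ i) (x $ j)) :: complex ^ 'n ^ 'n))\<^sup>2
    \<le> complex_of_real ((det (Cov \<phi> x))\<^sup>2)"
proof -
  have \<phi>: "positive_linear_functional \<phi>"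
    using assms(1) by (simp add: state_def)
  have sa: "selfadjoint (x $ j)" for j
    using assms(2) by blast
  note herm = positive_linear_functional_cnj[OF \<phi> sa sa]
  define C where "C = Cov \<phi> x"
  define S :: "real ^ 'n ^ 'n" where "S = (\<chi> i j. Im (\<phi> (x $ i * x $ j)))"
  \<comment> \<open>The bilinear forms of \<open>C\<close> and \<open>S\<close> are the real and imaginary parts of \<open>\<phi> (L u * L v)\<close>.\<close>
  define L where "L u = (\<Sum>i\<in>UNIV. u $ i *\<^sub>R x $ i)" for u :: "real ^ 'n"
  have L_sa: "selfadjoint (L u)" for u
    unfolding L_def by (intro selfadjoint_sum selfadjoint_scaleR sa)
  have L_mult: "\<phi> (L u * L v) = (\<Sum>i\<in>UNIV. \<Sum>j\<in>UNIV. of_real (u $ i * v $ j) * \<phi> (x $ i * x $ j))" for u v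
    by (simp add: L_def sum_product positive_linear_functional_sum[OF \<phi>]
        positive_linear_functional_scaleR[OF \<phi>] mult_ac)
  have C_form: "u \<bullet> (C *v v) = Re (\<phi> (L u * L v))" for u v
    by (simp add: L_mult C_def Cov_def inner_vec_def matrix_vector_mult_def sum_distrib_left mult_ac)
  have S_form: "u \<bullet> (S *v v) = Im (\<phi> (L u * L v))" for u v
    by (simp add: L_mult S_def inner_vec_def matrix_vector_mult_def sum_distrib_left mult_ac)
  have "transpose C = C"
    by (simp add: C_def Cov_def transpose_def vec_eq_iff) (metis herm complex_cnj(1) cnj.sel(1))
  then have "\<bar>det S\<bar> \<le> \<bar>det C\<bar>"
    by (rule abs_det_le_of_dominated_form)
      (simp add: C_form S_form positive_linear_functional_uncertainty[OF \<phi> L_sa L_sa])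
  then have le: "(det S)\<^sup>2 \<le> (det C)\<^sup>2"
    by (simp add: abs_le_square_iff)
  have "1 / 2 * \<phi> (commutator (x $ i) (x $ j)) = \<i> * complex_of_real (S $ i $ j)" for i j
    using herm[of j i]
    by (simp add: commutator_def positive_linear_functional_diff[OF \<phi>] S_def complex_eq_iff)
  then have "(\<chi> i j. 1 / 2 * \<phi> (commutator (x $ i) (x $ j)) :: complex ^ 'n ^ 'n)
      = (\<chi> i. \<i> *s (\<chi> i j. complex_of_real (S $ i $ j)) $ i)"
    by (simp add: vec_eq_iff)
  then have "det (\<chi> i j. 1 / 2 * \<phi> (commutator (x $ i) (x $ j)) :: complex ^ 'n ^ 'n)
      = \<i> ^ CARD('n) * complex_of_real (det S)"
    by (simp only: det_rows_mul det_complex_of_real vec_lambda_eta prod_constant)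
  moreover have i_pow: "(\<i> ^ CARD('n))\<^sup>2 = (- 1) ^ CARD('n)"
    by (metis power2_i power_mult mult.commute)
  ultimately have "(det (\<chi> i j. 1 / 2 * \<phi> (commutator (x $ i) (x $ j)) :: complex ^ 'n ^ 'n))\<^sup>2
      = (- 1) ^ CARD('n) * complex_of_real ((det S)\<^sup>2)"
    by (simp only: power_mult_distrib of_real_power i_pow)
  also have "\<dots> \<le> complex_of_real ((det C)\<^sup>2)"
  proof -
    have "- (det S)\<^sup>2 \<le> (det C)\<^sup>2"
      using zero_le_power2[of "det S"] zero_le_power2[of "det C"] by linarith
    with le show ?thesis
      by (cases "even CARD('n)") (simp_all add: less_eq_complex_def)
  qed
  finally show ?thesis
    by (simp add: C_def)
qed

end
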